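(* Let $M$ be a connected smooth manifold and let $(P,m,e,b)$ be an octonion algebra over $C^\infty(M)$. Write $xy=m(x\otimes y)$, write $1=e$, identify $h\in C^\infty(M)$ with $h\cdot e\in P$, and define $\bar x:=b(x\otimes 1)-x$. Then for all $x,y,z\in P$: $$xy+yx-b(y\otimes1)x-b(x\otimes1)y+b(x\otimes y)=0,$$ $$b(xy\otimes z)=b(y\otimes\bar xz),\qquad b(xy\otimes z)=b(x\otimes z\bar y),\qquad b(xy\otimes\bar z)=b(yz\otimes\bar x),$$ and $$b(x\otimes x)=2x\bar x .$$
   Context: An octonion algebra over $R=C^\infty(M)$ is $(P,m,e,b)$ with $P$ a finitely generated projective $R$-module of rank $8$, $m:P\otimes P\to P$ an $R$-linear (not necessarily commutative or associative) multiplication with two-sided identity $e$, and $b$ the symmetric bilinear form $b(x,y)=q(x+y)-q(x)-q(y)$ of a quadratic form $q:P\to R$ with $q(xy)=q(x)q(y)$ for all $x,y$, and such that $P\to P^\vee$, $x\mapsto b(x,-)$, is an isomorphism. *)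

theory Defs
  imports "HOL-Analysis.Analysis" "HOL-Algebra.Ideal" "HOL-Algebra.Module"
begin

section \<open>Smooth manifolds and their rings of smooth functions\<close>

text \<open>\<open>\<real>\<^sup>n\<close> is the space \<^const>\<open>Euclidean_space\<close>~\<open>n\<close> of sequences vanishing from index \<open>n\<close> on, so that
  the dimension is an arbitrary natural number, zero included.  The sets \<open>U\<close> below are open in it.
  Being of class \<open>C\<^sup>k\<close> means that all partial derivatives up to order \<open>k\<close> exist and are continuous;
  \<open>g i\<close> is the \<open>i\<close>-th partial derivative of \<open>f\<close>.\<close>

primrec Ck_on :: "nat \<Rightarrow> nat \<Rightarrow> (nat \<Rightarrow> real) set \<Rightarrow> ((nat \<Rightarrow> real) \<Rightarrow> real) \<Rightarrow> bool" where
  "Ck_on n 0 U f \<longleftrightarrow> continuous_map (subtopology (Euclidean_space n) U) euclideanreal f"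
| "Ck_on n (Suc k) U f \<longleftrightarrow>
     continuous_map (subtopology (Euclidean_space n) U) euclideanreal f \<and>
     (\<exists>g. \<forall>i<n. (\<forall>x\<in>U. ((\<lambda>t. f (x(i := t))) has_real_derivative g i x) (at (x i))) \<and>
                 Ck_on n k U (g i))"

definition smooth_on :: "nat \<Rightarrow> (nat \<Rightarrow> real) set \<Rightarrow> ((nat \<Rightarrow> real) \<Rightarrow> real) \<Rightarrow> bool" where
  "smooth_on n U f \<longleftrightarrow> (\<forall>k. Ck_on n k U f)"

text \<open>A chart is a pair of its domain and its coordinate map.\<close>

type_synonym 'm chart = "'m set \<times> ('m \<Rightarrow> nat \<Rightarrow> real)"

definition chart_on :: "nat \<Rightarrow> 'm topology \<Rightarrow> 'm chart \<Rightarrow> bool" where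
  "chart_on n X = (\<lambda>(U, \<phi>). openin X U \<and> openin (Euclidean_space n) (\<phi> ` U) \<and>
     homeomorphic_map (subtopology X U) (subtopology (Euclidean_space n) (\<phi> ` U)) \<phi>)"

definition smoothly_compatible :: "nat \<Rightarrow> 'm chart \<Rightarrow> 'm chart \<Rightarrow> bool" where
  "smoothly_compatible n = (\<lambda>(U, \<phi>) (V, \<psi>).
     \<forall>j<n. smooth_on n (\<phi> ` (U \<inter> V)) (\<lambda>x. \<psi> (inv_into U \<phi> x) j))"

text \<open>The smooth structure is presented by an atlas, which need not be maximal: an atlas and the
  maximal atlas containing it have the same smooth functions.\<close>

definition smooth_manifold :: "nat \<Rightarrow> 'm topology \<Rightarrow> 'm chart set \<Rightarrow> bool" where
  "smooth_manifold n X \<A> \<longleftrightarrow>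
     Hausdorff_space X \<and> second_countable X \<and>
     (\<forall>c\<in>\<A>. chart_on n X c) \<and> (\<Union>c\<in>\<A>. fst c) = topspace X \<and>
     (\<forall>c\<in>\<A>. \<forall>d\<in>\<A>. smoothly_compatible n c d)"

definition smooth_function :: "nat \<Rightarrow> 'm chart set \<Rightarrow> ('m \<Rightarrow> real) \<Rightarrow> bool" where
  "smooth_function n \<A> f \<longleftrightarrow> (\<forall>(U, \<phi>)\<in>\<A>. smooth_on n (\<phi> ` U) (\<lambda>x. f (inv_into U \<phi> x)))"

text \<open>Functions on the manifold are represented by functions that are \<^const>\<open>undefined\<close> outside of it.\<close>

definition C_infinity :: "nat \<Rightarrow> 'm topology \<Rightarrow> 'm chart set \<Rightarrow> ('m \<Rightarrow> real) ring" where
  "C_infinity n X \<A> =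
     \<lparr>carrier = {f \<in> extensional (topspace X). smooth_function n \<A> f},
      mult = (\<lambda>f g. \<lambda>x\<in>topspace X. f x * g x), one = (\<lambda>x\<in>topspace X. 1),
      zero = (\<lambda>x\<in>topspace X. 0), add = (\<lambda>f g. \<lambda>x\<in>topspace X. f x + g x)\<rparr>"

section \<open>Modules\<close>

text \<open>Modules are records extending rings.  The locale \<^locale>\<open>Module.module\<close> disregards the fields
  \<^const>\<open>mult\<close> and \<^const>\<open>one\<close> of a module, so these are left unspecified below.\<close>

definition regular_module :: "('r, 's) ring_scheme \<Rightarrow> ('r, 'r) module" where
  "regular_module R = \<lparr>carrier = carrier R, mult = undefined, one = undefined,
     zero = \<zero>\<^bsub>R\<^esub>, add = add R, smult = mult R\<rparr>"

definition free_module :: "('r, 's) ring_scheme \<Rightarrow> nat \<Rightarrow> ('r, nat \<Rightarrow> 'r) module" where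
  "free_module R n = \<lparr>carrier = {..<n} \<rightarrow>\<^sub>E carrier R, mult = undefined, one = undefined,
     zero = (\<lambda>i\<in>{..<n}. \<zero>\<^bsub>R\<^esub>), add = (\<lambda>v w. \<lambda>i\<in>{..<n}. v i \<oplus>\<^bsub>R\<^esub> w i),
     smult = (\<lambda>a v. \<lambda>i\<in>{..<n}. a \<otimes>\<^bsub>R\<^esub> v i)\<rparr>"

definition module_hom ::
    "('r, 's) ring_scheme \<Rightarrow> ('r, 'a, 't) module_scheme \<Rightarrow> ('r, 'b, 'u) module_scheme \<Rightarrow> ('a \<Rightarrow> 'b) \<Rightarrow> bool" where
  "module_hom R M N f \<longleftrightarrow> f \<in> carrier M \<rightarrow> carrier N \<and>
     (\<forall>x\<in>carrier M. \<forall>y\<in>carrier M. f (x \<oplus>\<^bsub>M\<^esub> y) = f x \<oplus>\<^bsub>N\<^esub> f y) \<and>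
     (\<forall>a\<in>carrier R. \<forall>x\<in>carrier M. f (a \<odot>\<^bsub>M\<^esub> x) = a \<odot>\<^bsub>N\<^esub> f x)"

definition module_iso ::
    "('r, 's) ring_scheme \<Rightarrow> ('r, 'a, 't) module_scheme \<Rightarrow> ('r, 'b, 'u) module_scheme \<Rightarrow> ('a \<Rightarrow> 'b) \<Rightarrow> bool" where
  "module_iso R M N f \<longleftrightarrow> module_hom R M N f \<and> bij_betw f (carrier M) (carrier N)"

text \<open>A linear map on \<open>M \<otimes> N\<close> is given by the corresponding bilinear map on \<open>M \<times> N\<close>.\<close>

definition bilinear_map ::
    "('r, 's) ring_scheme \<Rightarrow> ('r, 'a, 't) module_scheme \<Rightarrow> ('r, 'b, 'u) module_scheme \<Rightarrow>
     ('r, 'c, 'v) module_scheme \<Rightarrow> ('a \<Rightarrow> 'b \<Rightarrow> 'c) \<Rightarrow> bool" where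
  "bilinear_map R M N L f \<longleftrightarrow>
     (\<forall>x\<in>carrier M. module_hom R N L (f x)) \<and> (\<forall>y\<in>carrier N. module_hom R M L (\<lambda>x. f x y))"

definition dual_module ::
    "('r, 's) ring_scheme \<Rightarrow> ('r, 'a, 't) module_scheme \<Rightarrow> ('r, 'a \<Rightarrow> 'r) module" where
  "dual_module R M =
     \<lparr>carrier = {f \<in> extensional (carrier M). module_hom R M (regular_module R) f},
      mult = undefined, one = undefined,
      zero = (\<lambda>x\<in>carrier M. \<zero>\<^bsub>R\<^esub>), add = (\<lambda>f g. \<lambda>x\<in>carrier M. f x \<oplus>\<^bsub>R\<^esub> g x),
      smult = (\<lambda>a f. \<lambda>x\<in>carrier M. a \<otimes>\<^bsub>R\<^esub> f x)\<rparr>"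

text \<open>Finitely generated projective: a direct summand, via a split surjection, of some \<open>R\<^sup>n\<close>.\<close>

definition fin_gen_projective :: "('r, 's) ring_scheme \<Rightarrow> ('r, 'a, 't) module_scheme \<Rightarrow> bool" where
  "fin_gen_projective R M \<longleftrightarrow>
     (\<exists>n \<iota> \<pi>. module_hom R M (free_module R n) \<iota> \<and> module_hom R (free_module R n) M \<pi> \<and>
               (\<forall>x\<in>carrier M. \<pi> (\<iota> x) = x))"

definition free_of_rank :: "('r, 's) ring_scheme \<Rightarrow> ('r, 'a, 't) module_scheme \<Rightarrow> nat \<Rightarrow> bool" where
  "free_of_rank R M n \<longleftrightarrow> (\<exists>f. module_iso R (free_module R n) M f)"

text \<open>Localization at a multiplicative subset \<open>S\<close>.  The fraction \<open>x/s\<close> is the class of all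
  \<open>(y, t)\<close> with \<open>u (t x) = u (s y)\<close> for some \<open>u \<in> S\<close>.\<close>

definition fraction ::
    "('r, 'a, 't) module_scheme \<Rightarrow> 'r set \<Rightarrow> 'a \<Rightarrow> 'r \<Rightarrow> ('a \<times> 'r) set" where
  "fraction M S x s = {(y, t). y \<in> carrier M \<and> t \<in> S \<and>
     (\<exists>u\<in>S. u \<odot>\<^bsub>M\<^esub> (t \<odot>\<^bsub>M\<^esub> x) = u \<odot>\<^bsub>M\<^esub> (s \<odot>\<^bsub>M\<^esub> y))}"

definition numer :: "('a \<times> 'r) set \<Rightarrow> 'a" where
  "numer A = fst (SOME p. p \<in> A)"

definition denom :: "('a \<times> 'r) set \<Rightarrow> 'r" where
  "denom A = snd (SOME p. p \<in> A)"

definition localized_module ::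
    "('r, 's) ring_scheme \<Rightarrow> 'r set \<Rightarrow> ('r, 'a, 't) module_scheme \<Rightarrow>
     (('r \<times> 'r) set, ('a \<times> 'r) set) module" where
  "localized_module R S M =
     \<lparr>carrier = {fraction M S x s | x s. x \<in> carrier M \<and> s \<in> S},
      mult = undefined, one = undefined,
      zero = fraction M S \<zero>\<^bsub>M\<^esub> \<one>\<^bsub>R\<^esub>,
      add = (\<lambda>A B. fraction M S
               (denom B \<odot>\<^bsub>M\<^esub> numer A \<oplus>\<^bsub>M\<^esub> denom A \<odot>\<^bsub>M\<^esub> numer B) (denom A \<otimes>\<^bsub>R\<^esub> denom B)),
      smult = (\<lambda>C A. fraction M S (numer C \<odot>\<^bsub>M\<^esub> numer A) (denom C \<otimes>\<^bsub>R\<^esub> denom A))\<rparr>"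

definition localized_ring :: "('r, 's) ring_scheme \<Rightarrow> 'r set \<Rightarrow> ('r \<times> 'r) set ring" where
  "localized_ring R S =
     (let L = localized_module R S (regular_module R)
      in \<lparr>carrier = carrier L, mult = smult L, one = fraction (regular_module R) S \<one>\<^bsub>R\<^esub> \<one>\<^bsub>R\<^esub>,
          zero = zero L, add = add L\<rparr>)"

text \<open>Constant rank \<open>k\<close>: the stalk at every prime ideal is free of rank \<open>k\<close>.\<close>

definition has_rank :: "('r, 's) ring_scheme \<Rightarrow> ('r, 'a, 't) module_scheme \<Rightarrow> nat \<Rightarrow> bool" where
  "has_rank R M k \<longleftrightarrow> (\<forall>\<pp>. primeideal \<pp> R \<longrightarrow>
     free_of_rank (localized_ring R (carrier R - \<pp>)) (localized_module R (carrier R - \<pp>) M) k)"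

section \<open>Octonion algebras\<close>

definition polar_form ::
    "('r, 's) ring_scheme \<Rightarrow> ('r, 'a, 't) module_scheme \<Rightarrow> ('a \<Rightarrow> 'r) \<Rightarrow> 'a \<Rightarrow> 'a \<Rightarrow> 'r" where
  "polar_form R M q x y = q (x \<oplus>\<^bsub>M\<^esub> y) \<ominus>\<^bsub>R\<^esub> q x \<ominus>\<^bsub>R\<^esub> q y"

definition quadratic_form ::
    "('r, 's) ring_scheme \<Rightarrow> ('r, 'a, 't) module_scheme \<Rightarrow> ('a \<Rightarrow> 'r) \<Rightarrow> bool" where
  "quadratic_form R M q \<longleftrightarrow> q \<in> carrier M \<rightarrow> carrier R \<and>
     (\<forall>a\<in>carrier R. \<forall>x\<in>carrier M. q (a \<odot>\<^bsub>M\<^esub> x) = a [^]\<^bsub>R\<^esub> (2::nat) \<otimes>\<^bsub>R\<^esub> q x) \<and>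
     bilinear_map R M M (regular_module R) (polar_form R M q)"

definition octonion_algebra ::
    "('r, 's) ring_scheme \<Rightarrow> ('r, 'a, 't) module_scheme \<Rightarrow>
     ('a \<Rightarrow> 'a \<Rightarrow> 'a) \<Rightarrow> 'a \<Rightarrow> ('a \<Rightarrow> 'a \<Rightarrow> 'r) \<Rightarrow> bool" where
  "octonion_algebra R P m e b \<longleftrightarrow>
     Module.module R P \<and> fin_gen_projective R P \<and> has_rank R P 8 \<and>
     bilinear_map R P P P m \<and>
     e \<in> carrier P \<and> (\<forall>x\<in>carrier P. m e x = x \<and> m x e = x) \<and>
     (\<exists>q. quadratic_form R P q \<and>
          (\<forall>x\<in>carrier P. \<forall>y\<in>carrier P. q (m x y) = q x \<otimes>\<^bsub>R\<^esub> q y) \<and>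
          (\<forall>x\<in>carrier P. \<forall>y\<in>carrier P. b x y = polar_form R P q x y)) \<and>
     module_iso R P (dual_module R P) (\<lambda>x. restrict (b x) (carrier P))"

text \<open>The conjugate \<open>b(x, 1) - x\<close>, in which \<open>b(x, 1)\<close> stands for its multiple of the identity.\<close>

definition oct_conj ::
    "('r, 'a, 't) module_scheme \<Rightarrow> 'a \<Rightarrow> ('a \<Rightarrow> 'a \<Rightarrow> 'r) \<Rightarrow> 'a \<Rightarrow> 'a" where
  "oct_conj P e b x = b x e \<odot>\<^bsub>P\<^esub> e \<ominus>\<^bsub>P\<^esub> x"

end

theory Submission
  imports Defs
begin

text \<open>Linearizing \<open>q(xy) = q(x) q(y)\<close> in both arguments gives the exchange law
  \<open>b(xy, zw) + b(zy, xw) = b(x, z) b(y, w)\<close>.  Putting \<open>z = e\<close> or \<open>w = e\<close> yields the two adjunction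
  formulas, and the cyclic identity follows by applying one to each side.  For the first identity, pair
  its left-hand side with an arbitrary \<open>w\<close>: three instances of the exchange law make the result vanish,
  so nondegeneracy applies.  The last identity is the case \<open>x = y\<close> of the first.\<close>

locale composition_algebra = Module.module R P
  for R (structure) and P (structure) +
  fixes mul :: "'c \<Rightarrow> 'c \<Rightarrow> 'c" (infixl "\<star>" 75) and e :: 'c
    and q :: "'c \<Rightarrow> 'a" and b :: "'c \<Rightarrow> 'c \<Rightarrow> 'a"
  assumes mul_closed [simp]: "\<lbrakk>x \<in> carrier P; y \<in> carrier P\<rbrakk> \<Longrightarrow> x \<star> y \<in> carrier P"
    and mul_add_left: "\<lbrakk>x \<in> carrier P; y \<in> carrier P; z \<in> carrier P\<rbrakk>
      \<Longrightarrow> (x \<oplus>\<^bsub>P\<^esub> y) \<star> z = x \<star> z \<oplus>\<^bsub>P\<^esub> y \<star> z"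
    and mul_add_right: "\<lbrakk>x \<in> carrier P; y \<in> carrier P; z \<in> carrier P\<rbrakk>
      \<Longrightarrow> x \<star> (y \<oplus>\<^bsub>P\<^esub> z) = x \<star> y \<oplus>\<^bsub>P\<^esub> x \<star> z"
    and mul_smult_left: "\<lbrakk>a \<in> carrier R; x \<in> carrier P; y \<in> carrier P\<rbrakk>
      \<Longrightarrow> (a \<odot>\<^bsub>P\<^esub> x) \<star> y = a \<odot>\<^bsub>P\<^esub> (x \<star> y)"
    and mul_smult_right: "\<lbrakk>a \<in> carrier R; x \<in> carrier P; y \<in> carrier P\<rbrakk>
      \<Longrightarrow> x \<star> (a \<odot>\<^bsub>P\<^esub> y) = a \<odot>\<^bsub>P\<^esub> (x \<star> y)"
    and unit_closed [simp]: "e \<in> carrier P"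
    and unit_left [simp]: "x \<in> carrier P \<Longrightarrow> e \<star> x = x"
    and unit_right [simp]: "x \<in> carrier P \<Longrightarrow> x \<star> e = x"
    and norm_closed [simp]: "x \<in> carrier P \<Longrightarrow> q x \<in> carrier R"
    and norm_mul: "\<lbrakk>x \<in> carrier P; y \<in> carrier P\<rbrakk> \<Longrightarrow> q (x \<star> y) = q x \<otimes> q y"
    and polar: "\<lbrakk>x \<in> carrier P; y \<in> carrier P\<rbrakk> \<Longrightarrow> b x y = q (x \<oplus>\<^bsub>P\<^esub> y) \<ominus> q x \<ominus> q y"
    and polar_add_right: "\<lbrakk>x \<in> carrier P; y \<in> carrier P; z \<in> carrier P\<rbrakk>
      \<Longrightarrow> b x (y \<oplus>\<^bsub>P\<^esub> z) = b x y \<oplus> b x z"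
    and polar_smult_right: "\<lbrakk>a \<in> carrier R; x \<in> carrier P; y \<in> carrier P\<rbrakk>
      \<Longrightarrow> b x (a \<odot>\<^bsub>P\<^esub> y) = a \<otimes> b x y"
    and polar_nondegenerate: "\<lbrakk>x \<in> carrier P; y \<in> carrier P;
      \<And>w. w \<in> carrier P \<Longrightarrow> b x w = b y w\<rbrakk> \<Longrightarrow> x = y"
begin

abbreviation conj :: "'c \<Rightarrow> 'c" where "conj x \<equiv> oct_conj P e b x"

lemma polar_closed [simp]: "\<lbrakk>x \<in> carrier P; y \<in> carrier P\<rbrakk> \<Longrightarrow> b x y \<in> carrier R"
  by (simp add: polar)

lemma polar_sym: "\<lbrakk>x \<in> carrier P; y \<in> carrier P\<rbrakk> \<Longrightarrow> b x y = b y x"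
  by (simp add: polar M.a_comm R.minus_eq R.a_ac)

lemma norm_add: "\<lbrakk>x \<in> carrier P; y \<in> carrier P\<rbrakk> \<Longrightarrow> q (x \<oplus>\<^bsub>P\<^esub> y) = b x y \<oplus> q x \<oplus> q y"
  by (simp add: polar R.minus_eq R.a_assoc R.a_comm [of "q x" "q y"] R.r_neg1 R.l_neg)

lemma polar_add_left: "\<lbrakk>x \<in> carrier P; y \<in> carrier P; z \<in> carrier P\<rbrakk>
    \<Longrightarrow> b (x \<oplus>\<^bsub>P\<^esub> y) z = b x z \<oplus> b y z"
  by (metis M.a_closed polar_add_right polar_sym)

lemma polar_smult_left: "\<lbrakk>a \<in> carrier R; x \<in> carrier P; y \<in> carrier P\<rbrakk>
    \<Longrightarrow> b (a \<odot>\<^bsub>P\<^esub> x) y = a \<otimes> b x y"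
  by (metis smult_closed polar_smult_right polar_sym)

text \<open>Negation is scaling by minus one, so homogeneity suffices; the same holds for the two
  product rules that follow.\<close>

lemma polar_minus_right: "\<lbrakk>x \<in> carrier P; y \<in> carrier P\<rbrakk> \<Longrightarrow> b x (\<ominus>\<^bsub>P\<^esub> y) = \<ominus> b x y"
  by (metis M.a_inv_closed R.l_minus R.l_one R.one_closed R.a_inv_closed polar_closed
      polar_smult_right smult_l_minus smult_one)

lemma mul_minus_right: "\<lbrakk>x \<in> carrier P; y \<in> carrier P\<rbrakk> \<Longrightarrow> x \<star> (\<ominus>\<^bsub>P\<^esub> y) = \<ominus>\<^bsub>P\<^esub> (x \<star> y)"
  by (metis R.a_inv_closed R.one_closed mul_closed mul_smult_right smult_l_minus smult_one)

lemma mul_minus_left: "\<lbrakk>x \<in> carrier P; y \<in> carrier P\<rbrakk> \<Longrightarrow> (\<ominus>\<^bsub>P\<^esub> x) \<star> y = \<ominus>\<^bsub>P\<^esub> (x \<star> y)"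
  by (metis R.a_inv_closed R.one_closed mul_closed mul_smult_left smult_l_minus smult_one)

lemma conj_closed [simp]: "x \<in> carrier P \<Longrightarrow> conj x \<in> carrier P"
  by (simp add: oct_conj_def)

text \<open>First polarization of multiplicativity, in the right factor only: the three norms making
  up the polar form on the left, at \<open>x \<star> (y + z)\<close>, \<open>x \<star> y\<close> and
  \<open>x \<star> z\<close>, all carry the factor \<open>q x\<close>.\<close>

lemma polar_mul_left_scale:
  assumes "x \<in> carrier P" "y \<in> carrier P" "z \<in> carrier P"
  shows "b (x \<star> y) (x \<star> z) = q x \<otimes> b y z"
  using assms
  by (simp add: polar mul_add_right [symmetric] norm_mul R.minus_eq R.r_distr R.r_minus)

lemma polar_exchange:
  assumes [simp]: "x \<in> carrier P" "y \<in> carrier P" "z \<in> carrier P" "w \<in> carrier P"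
  shows "b (x \<star> y) (z \<star> w) \<oplus> b (z \<star> y) (x \<star> w) = b x z \<otimes> b y w"
proof -
  let ?A = "q x \<otimes> b y w" and ?B = "q z \<otimes> b y w" and ?C = "b x z \<otimes> b y w"
  let ?S = "b (x \<star> y) (z \<star> w) \<oplus> b (z \<star> y) (x \<star> w)"
  \<comment> \<open>Second polarization, in the left factor: \<open>?A\<close> and \<open>?B\<close>
    are the diagonal terms \<open>b (x \<star> y) (x \<star> w)\<close> and
    \<open>b (z \<star> y) (z \<star> w)\<close>, which complete \<open>?S\<close> to a full
    bilinear expansion.\<close>
  have "?S \<oplus> (?A \<oplus> ?B) = b ((x \<oplus>\<^bsub>P\<^esub> z) \<star> y) ((x \<oplus>\<^bsub>P\<^esub> z) \<star> w)"
    by (simp add: mul_add_left polar_add_left polar_add_right polar_mul_left_scale R.a_ac)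
  \<comment> \<open>Now the left factor \<open>x + z\<close> comes out as \<open>q (x + z)\<close>,
    whose expansion produces the same diagonal terms, ready to be cancelled.\<close>
  also have "\<dots> = ?C \<oplus> (?A \<oplus> ?B)"
    by (simp add: polar_mul_left_scale norm_add R.l_distr R.a_ac)
  finally show ?thesis
    using R.add.right_cancel by simp
qed

lemma adjoint_left:
  assumes [simp]: "x \<in> carrier P" "y \<in> carrier P" "z \<in> carrier P"
  shows "b (x \<star> y) z = b y (conj x \<star> z)"
proof -
  \<comment> \<open>The scalar \<open>b x e\<close> on the right is the trace of \<open>x\<close>,
    and \<open>conj x\<close> is trace minus \<open>x\<close>, so moving the second summand across
    gives the conjugate.\<close>
  have "b (x \<star> y) z \<oplus> b y (x \<star> z) = b x e \<otimes> b y z"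
    using polar_exchange [of x y e z] by simp
  then have "b (x \<star> y) z = b x e \<otimes> b y z \<ominus> b y (x \<star> z)"
    using R.minus_eq R.a_assoc R.r_neg R.r_zero
    by (metis R.add.inv_solve_right assms mul_closed polar_closed R.m_closed unit_closed)
  then show ?thesis
    by (simp add: oct_conj_def M.minus_eq R.minus_eq mul_add_left mul_smult_left mul_minus_left
        polar_add_right polar_smult_right polar_minus_right)
qed

lemma adjoint_right:
  assumes [simp]: "x \<in> carrier P" "y \<in> carrier P" "z \<in> carrier P"
  shows "b (x \<star> y) z = b x (z \<star> conj y)"
proof -
  have "b (x \<star> y) z \<oplus> b x (z \<star> y) = b y e \<otimes> b x z"
    \<comment> \<open>Here the unit sits in the last slot, so the trace of \<open>y\<close> appears
      instead; symmetry moves \<open>z \<star> y\<close> into the second argument.\<close>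
    using polar_exchange [of x y z e] by (simp add: polar_sym [of "z \<star> y"] R.m_comm)
  then have "b (x \<star> y) z = b y e \<otimes> b x z \<ominus> b x (z \<star> y)"
    using R.minus_eq R.a_assoc R.r_neg R.r_zero
    by (metis R.add.inv_solve_right assms mul_closed polar_closed R.m_closed unit_closed)
  then show ?thesis
    by (simp add: oct_conj_def M.minus_eq R.minus_eq mul_add_right mul_smult_right mul_minus_right
        polar_add_right polar_smult_right polar_minus_right)
qed

text \<open>Both sides equal \<open>b y (conj x \<star> conj z)\<close>, so no rule for the
  conjugate of a conjugate or of a product is involved.\<close>

lemma polar_cyclic:
  assumes "x \<in> carrier P" "y \<in> carrier P" "z \<in> carrier P"
  shows "b (x \<star> y) (conj z) = b (y \<star> z) (conj x)"
  using assms by (simp add: adjoint_left [of x] adjoint_right [of y])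

text \<open>This polarizes the Cayley-Hamilton identity \<open>x^2 - b(x,e) x + q(x) e = 0\<close>.
  Moving the negative terms to the right makes pairing with \<open>w\<close> a matter of additivity
  and homogeneity alone.\<close>

lemma linearized_quadratic_equation:
  assumes [simp]: "x \<in> carrier P" "y \<in> carrier P"
  shows "x \<star> y \<oplus>\<^bsub>P\<^esub> y \<star> x \<oplus>\<^bsub>P\<^esub> b x y \<odot>\<^bsub>P\<^esub> e = b y e \<odot>\<^bsub>P\<^esub> x \<oplus>\<^bsub>P\<^esub> b x e \<odot>\<^bsub>P\<^esub> y"
proof (rule polar_nondegenerate)
  fix w assume [simp]: "w \<in> carrier P"
  have "b (x \<star> y \<oplus>\<^bsub>P\<^esub> y \<star> x \<oplus>\<^bsub>P\<^esub> b x y \<odot>\<^bsub>P\<^esub> e) w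
      = b (x \<star> y) w \<oplus> b (y \<star> x) w \<oplus> (b x (y \<star> w) \<oplus> b y (x \<star> w))"
    \<comment> \<open>With the unit in the second slot, the exchange law splits
      \<open>b x y \<otimes> b e w\<close>, the contribution of the last summand.\<close>
    using polar_exchange [of x e y w] by (simp add: polar_add_left polar_smult_left)
  \<comment> \<open>Regrouped so that each bracket is an instance of the exchange law with the unit
    in the third slot.\<close>
  also have "\<dots> = (b (y \<star> x) w \<oplus> b x (y \<star> w)) \<oplus> (b (x \<star> y) w \<oplus> b y (x \<star> w))"
    by (simp add: R.a_ac)
  also have "\<dots> = b y e \<otimes> b x w \<oplus> b x e \<otimes> b y w"
    using polar_exchange [of x y e w] polar_exchange [of y x e w] by simp
  finally show "b (x \<star> y \<oplus>\<^bsub>P\<^esub> y \<star> x \<oplus>\<^bsub>P\<^esub> b x y \<odot>\<^bsub>P\<^esub> e) w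
      = b (b y e \<odot>\<^bsub>P\<^esub> x \<oplus>\<^bsub>P\<^esub> b x e \<odot>\<^bsub>P\<^esub> y) w"
    by (simp add: polar_add_left polar_smult_left)
qed simp_all

lemma linearized_quadratic_equation_eq_zero:
  assumes [simp]: "x \<in> carrier P" "y \<in> carrier P"
  shows "x \<star> y \<oplus>\<^bsub>P\<^esub> y \<star> x \<ominus>\<^bsub>P\<^esub> b y e \<odot>\<^bsub>P\<^esub> x \<ominus>\<^bsub>P\<^esub> b x e \<odot>\<^bsub>P\<^esub> y \<oplus>\<^bsub>P\<^esub> b x y \<odot>\<^bsub>P\<^esub> e = \<zero>\<^bsub>P\<^esub>"
proof -
  have "x \<star> y \<oplus>\<^bsub>P\<^esub> y \<star> x \<ominus>\<^bsub>P\<^esub> b y e \<odot>\<^bsub>P\<^esub> x \<ominus>\<^bsub>P\<^esub> b x e \<odot>\<^bsub>P\<^esub> y \<oplus>\<^bsub>P\<^esub> b x y \<odot>\<^bsub>P\<^esub> e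
      = (x \<star> y \<oplus>\<^bsub>P\<^esub> y \<star> x \<oplus>\<^bsub>P\<^esub> b x y \<odot>\<^bsub>P\<^esub> e) \<ominus>\<^bsub>P\<^esub> (b y e \<odot>\<^bsub>P\<^esub> x \<oplus>\<^bsub>P\<^esub> b x e \<odot>\<^bsub>P\<^esub> y)"
    by (simp add: M.minus_eq M.minus_add M.a_ac)
  then show ?thesis
    by (simp add: linearized_quadratic_equation M.minus_eq M.r_neg)
qed

lemma polar_self:
  assumes [simp]: "x \<in> carrier P"
  shows "b x x \<odot>\<^bsub>P\<^esub> e = [(2::nat)] \<cdot>\<^bsub>P\<^esub> (x \<star> conj x)"
proof -
  let ?t = "b x e \<odot>\<^bsub>P\<^esub> x" and ?s = "x \<star> x"
  \<comment> \<open>Adding and subtracting \<open>?s\<close> twice exposes the left-hand side of the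
    linearized equation at \<open>y = x\<close>, whose right-hand side is then twice
    \<open>?t\<close>.\<close>
  have "b x x \<odot>\<^bsub>P\<^esub> e = (?s \<oplus>\<^bsub>P\<^esub> ?s \<oplus>\<^bsub>P\<^esub> b x x \<odot>\<^bsub>P\<^esub> e) \<ominus>\<^bsub>P\<^esub> (?s \<oplus>\<^bsub>P\<^esub> ?s)"
    by (simp add: M.minus_eq M.minus_add M.a_ac M.r_neg M.r_neg1 M.r_neg2)
  also have "\<dots> = (?t \<oplus>\<^bsub>P\<^esub> ?t) \<ominus>\<^bsub>P\<^esub> (?s \<oplus>\<^bsub>P\<^esub> ?s)"
    by (simp add: linearized_quadratic_equation)
  also have "\<dots> = (?t \<ominus>\<^bsub>P\<^esub> ?s) \<oplus>\<^bsub>P\<^esub> (?t \<ominus>\<^bsub>P\<^esub> ?s)"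
    by (simp add: M.minus_eq M.minus_add M.a_ac)
  also have "?t \<ominus>\<^bsub>P\<^esub> ?s = x \<star> conj x"
    by (simp add: oct_conj_def M.minus_eq mul_add_right mul_smult_right mul_minus_right)
  also have "x \<star> conj x \<oplus>\<^bsub>P\<^esub> x \<star> conj x = [(2::nat)] \<cdot>\<^bsub>P\<^esub> (x \<star> conj x)"
    by (simp add: numeral_2_eq_2)
  finally show ?thesis .
qed

end

text \<open>Passes from the structure over a ring to the elementwise laws used above. Nondegeneracy
  comes from injectivity of the map into the dual.\<close>

lemma octonion_algebra_composition_algebra:
  assumes "octonion_algebra R P m e b"
  obtains q where "composition_algebra R P m e q b"
proof -
  obtain q where q: "quadratic_form R P q"
      "\<forall>x\<in>carrier P. \<forall>y\<in>carrier P. q (m x y) = q x \<otimes>\<^bsub>R\<^esub> q y"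
      "\<forall>x\<in>carrier P. \<forall>y\<in>carrier P. b x y = polar_form R P q x y"
    using assms by (auto simp: octonion_algebra_def)
  interpret Module.module R P
    using assms by (simp add: octonion_algebra_def)
  have m: "bilinear_map R P P P m"
    using assms by (simp add: octonion_algebra_def)
  have b: "module_hom R P (regular_module R) (polar_form R P q x)" if "x \<in> carrier P" for x
    using q(1) that by (simp add: quadratic_form_def bilinear_map_def)
  have inj: "inj_on (\<lambda>x. restrict (b x) (carrier P)) (carrier P)"
    using assms by (simp add: octonion_algebra_def module_iso_def bij_betw_def)
  have "composition_algebra R P m e q b"
  proof (unfold_locales, goal_cases)
    \<comment> \<open>Homogeneity of \<open>b\<close> in its second argument, read off from the
      polar form of \<open>q\<close>.\<close>
    case (13 a x y)
    then show ?case
      using b q(3) by (simp add: module_hom_def regular_module_def)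
  next
    \<comment> \<open>Nondegeneracy: functionals agreeing on the carrier have equal restrictions,
      hence are the same element of the dual.\<close>
    case (14 x y)
    then show ?case
      using inj by (auto intro!: inj_onD [OF inj] restrict_ext)
  qed (use assms m q b in \<open>auto simp: octonion_algebra_def bilinear_map_def module_hom_def
      quadratic_form_def polar_form_def regular_module_def Pi_iff\<close>)
  then show thesis
    by (rule that)
qed

theorem proposition4p18:
  fixes n :: nat and X :: "'m topology" and \<A> :: "'m chart set"
    and P :: "('m \<Rightarrow> real, 'p) module"
    and m :: "'p \<Rightarrow> 'p \<Rightarrow> 'p" and e :: 'p and b :: "'p \<Rightarrow> 'p \<Rightarrow> 'm \<Rightarrow> real"
    and x y z :: 'p
  assumes "smooth_manifold n X \<A>" and "connected_space X"
    and "octonion_algebra (C_infinity n X \<A>) P m e b"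
    and "x \<in> carrier P" and "y \<in> carrier P" and "z \<in> carrier P"
  shows "m x y \<oplus>\<^bsub>P\<^esub> m y x \<ominus>\<^bsub>P\<^esub> b y e \<odot>\<^bsub>P\<^esub> x \<ominus>\<^bsub>P\<^esub> b x e \<odot>\<^bsub>P\<^esub> y \<oplus>\<^bsub>P\<^esub> b x y \<odot>\<^bsub>P\<^esub> e = \<zero>\<^bsub>P\<^esub> \<and>
    b (m x y) z = b y (m (oct_conj P e b x) z) \<and>
    b (m x y) z = b x (m z (oct_conj P e b y)) \<and>
    b (m x y) (oct_conj P e b z) = b (m y z) (oct_conj P e b x) \<and>
    b x x \<odot>\<^bsub>P\<^esub> e = [(2::nat)] \<cdot>\<^bsub>P\<^esub> m x (oct_conj P e b x)"
proof -
  obtain q where "composition_algebra (C_infinity n X \<A>) P m e q b"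
    using assms(3) by (rule octonion_algebra_composition_algebra)
  then interpret composition_algebra "C_infinity n X \<A>" P m e q b .
  from assms(4-6) show ?thesis
    by (intro conjI linearized_quadratic_equation_eq_zero adjoint_left adjoint_right polar_cyclic polar_self)
qed

end
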